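(* Let $k$ be a field of characteristic $\neq 2,3$ and $A$ a vector space over $k$. Then: (1) There exists a bijection $$\mathbb{GH}^2\bigl(A_0,k\bigr)=\mathbb{H}^2\bigl(A_0,k_0\bigr)\cong\mathrm{Sym}(A\times A,k)$$ given such that the crossed product $A_\vartheta:=A_0\#k_0$ associated to $\vartheta\in\mathrm{Sym}(A\times A,k)$ is the Jacobi-Jordan (JJ) algebra on $A\times k$ with the multiplication given for any $a,b\in A$, $x,y\in k$ by $$(a,x)\bullet(b,y)=\bigl(0,\ \vartheta(a,b)\bigr).$$ (2) A metabelian JJ algebra has the derived algebra of dimension $1$ if and only if it is isomorphic to $A_\vartheta$, for some vector space $A$ and $0\neq\vartheta\in\mathrm{Sym}(A\times A,k)$. (3) Two JJ algebras $A_\vartheta$ and $A_{\vartheta'}$ (with $\vartheta,\vartheta'\in\mathrm{Sym}(A\times A,k)$) are isomorphic if and only if the symmetric bilinear forms $\vartheta$ and $\vartheta'$ are homothetic, i.e. there exists a pair $(s_0,\psi)\in k^*\times\mathrm{Aut}_k(A)$ such that $s_0\,\vartheta(a,b)=\vartheta'\bigl(\psi(a),\psi(b)\bigr)$ for all $a,b\in A$.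
   Context: A JJ algebra is a $k$-vector space $J$ with a bilinear map $\cdot:J\times J\to J$ such that $a\cdot b=b\cdot a$ and $a\cdot(b\cdot c)+b\cdot(c\cdot a)+c\cdot(a\cdot b)=0$. The derived algebra $J'$ is the span of all products $a\cdot b$; $J$ is metabelian if $(a\cdot b)\cdot(c\cdot d)=0$ for all $a,b,c,d\in J$. $A_0$ and $k_0$ denote $A$ and $k$ with zero multiplication; $\mathrm{Sym}(A\times A,k)$ is the space of symmetric bilinear forms on $A$; $\mathrm{Aut}_k(A)$ is the group of linear automorphisms of $A$; $k^*=k\setminus\{0\}$. For a JJ algebra $(A,\cdot)$ and vector space $V$, $\mathcal{CS}(A,V)$ is the set of crossed systems: triples $(\triangleright,\vartheta,\cdot_V)$ of bilinear maps $\triangleright:A\times V\to V$, $\vartheta:A\times A\to V$, $\cdot_V:V\times V\to V$ such that $A\times V$ with multiplication $(a,x)\bullet(b,y):=(a\cdot b,\ \vartheta(a,b)+a\triangleright y+b\triangleright x+x\cdot_V y)$ is a JJ algebra, called the crossed product $A\#V$. $(\triangleright,\vartheta,\cdot_V)\approx(\triangleright',\vartheta',\cdot_V')$ means $\cdot_V=\cdot_V'$ and there is a linear map $r:A\to V$ with $a\triangleright x=a\triangleright' x+r(a)\cdot_V' x$ and $\vartheta(a,b)=\vartheta'(a,b)+a\triangleright' r(b)+b\triangleright' r(a)+r(a)\cdot_V' r(b)-r(a\cdot b)$ for all $a,b\in A$, $x\in V$. $\mathbb{GH}^2(A,V):=\mathcal{CS}(A,V)/\approx$, and for a fixed JJ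 structure $\cdot_V$ on $V$, $\mathbb{H}^2(A,(V,\cdot_V))$ is the subset of classes of crossed systems whose third component is $\cdot_V$. *)

theory Defs
  imports "HOL-Analysis.Product_Vector"
begin

text \<open>
  A vector space over the field \<^typ>\<open>'k\<close> is given by a scalar multiplication on an ambient type
  together with a subspace of that type as its carrier (\<^term>\<open>UNIV\<close> when the whole type is meant).
  Carriers are needed only in order to quantify existentially over vector spaces. A function
  is constrained on the carrier only, so function sets such as \<open>sym_forms\<close> are the intended
  sets of maps exactly when the carrier is \<^term>\<open>UNIV\<close>.
\<close>

definition linear_on ::
  "'a set \<Rightarrow> ('k::field \<Rightarrow> 'a::ab_group_add \<Rightarrow> 'a) \<Rightarrow> ('k \<Rightarrow> 'b::ab_group_add \<Rightarrow> 'b)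
    \<Rightarrow> ('a \<Rightarrow> 'b) \<Rightarrow> bool"
  where "linear_on S s1 s2 f \<longleftrightarrow>
    (\<forall>x\<in>S. \<forall>y\<in>S. f (x + y) = f x + f y) \<and> (\<forall>c. \<forall>x\<in>S. f (s1 c x) = s2 c (f x))"

definition bilinear_on ::
  "'a set \<Rightarrow> 'b set \<Rightarrow> ('k::field \<Rightarrow> 'a::ab_group_add \<Rightarrow> 'a) \<Rightarrow> ('k \<Rightarrow> 'b::ab_group_add \<Rightarrow> 'b)
    \<Rightarrow> ('k \<Rightarrow> 'c::ab_group_add \<Rightarrow> 'c) \<Rightarrow> ('a \<Rightarrow> 'b \<Rightarrow> 'c) \<Rightarrow> bool"
  where "bilinear_on S T s1 s2 s3 f \<longleftrightarrow>
    (\<forall>y\<in>T. linear_on S s1 s3 (\<lambda>x. f x y)) \<and> (\<forall>x\<in>S. linear_on T s2 s3 (f x))"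

definition sym_forms ::
  "'a set \<Rightarrow> ('k::field \<Rightarrow> 'a::ab_group_add \<Rightarrow> 'a) \<Rightarrow> ('a \<Rightarrow> 'a \<Rightarrow> 'k) set"
  where "sym_forms S s =
    {\<theta>. bilinear_on S S s s (*) \<theta> \<and> (\<forall>a\<in>S. \<forall>b\<in>S. \<theta> a b = \<theta> b a)}"

definition jj_algebra_on ::
  "'a set \<Rightarrow> ('k::field \<Rightarrow> 'a::ab_group_add \<Rightarrow> 'a) \<Rightarrow> ('a \<Rightarrow> 'a \<Rightarrow> 'a) \<Rightarrow> bool"
  where "jj_algebra_on J s m \<longleftrightarrow>
    vector_space s \<and> module.subspace s J \<and>
    (\<forall>a\<in>J. \<forall>b\<in>J. m a b \<in> J) \<and> bilinear_on J J s s s m \<and>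
    (\<forall>a\<in>J. \<forall>b\<in>J. m a b = m b a) \<and>
    (\<forall>a\<in>J. \<forall>b\<in>J. \<forall>c\<in>J. m a (m b c) + m b (m c a) + m c (m a b) = 0)"

definition metabelian_on :: "'a::zero set \<Rightarrow> ('a \<Rightarrow> 'a \<Rightarrow> 'a) \<Rightarrow> bool"
  where "metabelian_on J m \<longleftrightarrow> (\<forall>a\<in>J. \<forall>b\<in>J. \<forall>c\<in>J. \<forall>d\<in>J. m (m a b) (m c d) = 0)"

definition derived_algebra ::
  "'a set \<Rightarrow> ('k::field \<Rightarrow> 'a::ab_group_add \<Rightarrow> 'a) \<Rightarrow> ('a \<Rightarrow> 'a \<Rightarrow> 'a) \<Rightarrow> 'a set"
  where "derived_algebra J s m = module.span s {m a b | a b. a \<in> J \<and> b \<in> J}"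

definition algebras_isomorphic ::
  "'a set \<Rightarrow> ('k::field \<Rightarrow> 'a::ab_group_add \<Rightarrow> 'a) \<Rightarrow> ('a \<Rightarrow> 'a \<Rightarrow> 'a)
    \<Rightarrow> 'b set \<Rightarrow> ('k \<Rightarrow> 'b::ab_group_add \<Rightarrow> 'b) \<Rightarrow> ('b \<Rightarrow> 'b \<Rightarrow> 'b) \<Rightarrow> bool"
  where "algebras_isomorphic J s m J' s' m' \<longleftrightarrow>
    (\<exists>f. bij_betw f J J' \<and> linear_on J s s' f \<and>
      (\<forall>a\<in>J. \<forall>b\<in>J. f (m a b) = m' (f a) (f b)))"

text \<open>A crossed system is a triple \<open>(t, \<theta>, mV)\<close>: action, cocycle, multiplication on \<open>V\<close>.\<close>

type_synonym ('a, 'v) crossed_datum =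
  "('a \<Rightarrow> 'v \<Rightarrow> 'v) \<times> ('a \<Rightarrow> 'a \<Rightarrow> 'v) \<times> ('v \<Rightarrow> 'v \<Rightarrow> 'v)"

fun crossed_mult ::
  "('a \<Rightarrow> 'a \<Rightarrow> 'a) \<Rightarrow> ('a, 'v::ab_group_add) crossed_datum \<Rightarrow> 'a \<times> 'v \<Rightarrow> 'a \<times> 'v \<Rightarrow> 'a \<times> 'v"
  where "crossed_mult mA (t, \<theta>, mV) (a, x) (b, y) = (mA a b, \<theta> a b + t a y + t b x + mV x y)"

definition crossed_systems ::
  "('k::field \<Rightarrow> 'a::ab_group_add \<Rightarrow> 'a) \<Rightarrow> ('a \<Rightarrow> 'a \<Rightarrow> 'a) \<Rightarrow> ('k \<Rightarrow> 'v::ab_group_add \<Rightarrow> 'v)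
    \<Rightarrow> ('a, 'v) crossed_datum set"
  where "crossed_systems sA mA sV =
    {(t, \<theta>, mV).
      bilinear_on UNIV UNIV sA sV sV t \<and> bilinear_on UNIV UNIV sA sA sV \<theta> \<and>
      bilinear_on UNIV UNIV sV sV sV mV \<and>
      jj_algebra_on UNIV (module_prod.scale sA sV) (crossed_mult mA (t, \<theta>, mV))}"

definition crossed_equiv ::
  "('k::field \<Rightarrow> 'a::ab_group_add \<Rightarrow> 'a) \<Rightarrow> ('a \<Rightarrow> 'a \<Rightarrow> 'a) \<Rightarrow> ('k \<Rightarrow> 'v::ab_group_add \<Rightarrow> 'v)
    \<Rightarrow> (('a, 'v) crossed_datum \<times> ('a, 'v) crossed_datum) set"
  where "crossed_equiv sA mA sV =
    {((t, \<theta>, mV), (t', \<theta>', mV')).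
      (t, \<theta>, mV) \<in> crossed_systems sA mA sV \<and> (t', \<theta>', mV') \<in> crossed_systems sA mA sV \<and>
      mV = mV' \<and>
      (\<exists>r. Vector_Spaces.linear sA sV r \<and>
        (\<forall>a x. t a x = t' a x + mV' (r a) x) \<and>
        (\<forall>a b. \<theta> a b = \<theta>' a b + t' a (r b) + t' b (r a) + mV' (r a) (r b) - r (mA a b)))}"

definition GH2 ::
  "('k::field \<Rightarrow> 'a::ab_group_add \<Rightarrow> 'a) \<Rightarrow> ('a \<Rightarrow> 'a \<Rightarrow> 'a) \<Rightarrow> ('k \<Rightarrow> 'v::ab_group_add \<Rightarrow> 'v)
    \<Rightarrow> ('a, 'v) crossed_datum set set"
  where "GH2 sA mA sV = crossed_systems sA mA sV // crossed_equiv sA mA sV"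

definition H2 ::
  "('k::field \<Rightarrow> 'a::ab_group_add \<Rightarrow> 'a) \<Rightarrow> ('a \<Rightarrow> 'a \<Rightarrow> 'a) \<Rightarrow> ('k \<Rightarrow> 'v::ab_group_add \<Rightarrow> 'v)
    \<Rightarrow> ('v \<Rightarrow> 'v \<Rightarrow> 'v) \<Rightarrow> ('a, 'v) crossed_datum set set"
  where "H2 sA mA sV mV =
    {p \<in> crossed_systems sA mA sV. snd (snd p) = mV} // crossed_equiv sA mA sV"

definition zero_mult :: "'a \<Rightarrow> 'b \<Rightarrow> 'c::zero"
  where "zero_mult = (\<lambda>_ _. 0)"

text \<open>
  The multiplication of \<open>A\<^sub>\<theta> = A\<^sub>0 # k\<^sub>0\<close>. If \<open>A\<close> has carrier \<open>S\<close>, then \<open>A\<^sub>\<theta>\<close> has carrier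
  \<open>S \<times> UNIV\<close> and scalar multiplication \<open>form_scale\<close>.
\<close>

definition form_mult ::
  "('a \<Rightarrow> 'a \<Rightarrow> 'k::field) \<Rightarrow> 'a::ab_group_add \<times> 'k \<Rightarrow> 'a \<times> 'k \<Rightarrow> 'a \<times> 'k"
  where "form_mult \<theta> = crossed_mult zero_mult (zero_mult, \<theta>, zero_mult)"

abbreviation form_scale ::
  "('k::field \<Rightarrow> 'a::ab_group_add \<Rightarrow> 'a) \<Rightarrow> 'k \<Rightarrow> 'a \<times> 'k \<Rightarrow> 'a \<times> 'k"
  where "form_scale s \<equiv> module_prod.scale s (*)"

end

theory Submission
  imports Defs "HOL-Computational_Algebra.Primes"
begin

text \<open>
  If all products of a JJ algebra lie on a line \<open>kv\<close>, the Jacobi identity on \<open>(v, v, v)\<close> and on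
  \<open>(a, a, v)\<close> forces \<open>v\<close> to annihilate the algebra, as the eigenvalue \<open>c\<close> in \<open>a \<cdot> v = c v\<close> satisfies
  \<open>3 c\<^sup>2 = 0\<close> for \<open>a = v\<close> and then \<open>2 c\<^sup>2 = 0\<close> in general. This applies to \<open>A\<^sub>0 # k\<close> with \<open>v = (0, 1)\<close>, where it
  kills the action and the multiplication of \<open>k\<close> and leaves the cocycle as the only datum; and
  to any JJ algebra with derived algebra \<open>kv\<close>, which therefore splits as \<open>A \<times> kv\<close> for any
  complement \<open>A\<close> of \<open>kv\<close>. An isomorphism from \<open>A\<^sub>\<theta>\<close> to \<open>A\<^sub>\<eta>\<close> with \<open>\<theta> \<noteq> 0\<close> maps \<open>0 \<times> k\<close>, the
  derived algebra, to \<open>0 \<times> k\<close> by a scalar \<open>s\<^sub>0\<close> and induces \<open>\<psi>\<close> on the quotients \<open>A\<close>.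
\<close>

section \<open>The characteristic, the space \<open>A \<times> k\<close>, and zeros of bilinear
  maps\<close>

lemma prime_neq_0_if_CHAR:
  assumes "prime p" and "CHAR('k) \<noteq> p"
  shows "(of_nat p :: 'k::field) \<noteq> 0"
proof
  assume "(of_nat p :: 'k) = 0"
  then have "CHAR('k) dvd p"
    by (simp add: of_nat_eq_0_iff_char_dvd)
  \<comment> \<open>A field never has characteristic 1, so as a divisor of the prime
    \<open>p\<close> it would be \<open>p\<close>.\<close>
  then show False
    using assms by (metis CHAR_not_1' One_nat_def prime_nat_iff)
qed

lemma vector_space_pair_field:
  "vector_space s \<Longrightarrow> vector_space_pair s ((*) :: 'k::field \<Rightarrow> 'k \<Rightarrow> 'k)"
  by (simp add: vector_space_pair_def vector_space_def algebra_simps)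

lemma form_scale_apply:
  assumes "vector_space s"
  shows "form_scale s c (a, x) = (s c a, c * x)"
proof -
  interpret vector_space_prod s "(*)"
    using vector_space_pair_field[OF assms] by (simp add: vector_space_prod_def)
  show ?thesis by (rule scale_prod)
qed

lemma form_scale_vector_space:
  assumes "vector_space s"
  shows "vector_space (form_scale s)"
proof -
  interpret vector_space_prod s "(*)"
    using vector_space_pair_field[OF assms] by (simp add: vector_space_prod_def)
  show ?thesis by unfold_locales
qed

lemma form_mult_apply: "form_mult \<theta> (a, x) (b, y) = (0, \<theta> a b)"
  by (simp add: form_mult_def zero_mult_def)

lemma bilinear_on_zero:
  assumes "bilinear_on UNIV UNIV s1 s2 s3 f"
  shows "f 0 y = 0" and "f x 0 = 0"
proof -
  have "f (0 + 0) y = f 0 y + f 0 y" "f x (0 + 0) = f x 0 + f x 0"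
    using assms unfolding bilinear_on_def linear_on_def by blast+
  then show "f 0 y = 0" "f x 0 = 0"
    by (metis add.right_neutral add_left_cancel)+
qed

section \<open>JJ algebras whose products lie on a line\<close>

lemma jj_products_in_line_annihilate:
  fixes s :: "'k::field \<Rightarrow> 'a::ab_group_add \<Rightarrow> 'a"
  assumes jj: "jj_algebra_on UNIV s m" and "CHAR('k) \<noteq> 2" "CHAR('k) \<noteq> 3"
    and line: "\<And>a b. \<exists>c. m a b = s c v"
  shows "m a v = 0" and "m v a = 0"
proof -
  interpret vector_space s
    using jj by (simp add: jj_algebra_on_def)
  have scale_right: "m a (s c b) = s c (m a b)" for a b c
    using jj by (simp add: jj_algebra_on_def bilinear_on_def linear_on_def)
  have comm: "m a b = m b a" for a b
    using jj by (simp add: jj_algebra_on_def)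
  have jac: "m a (m b c) + m b (m c a) + m c (m a b) = 0" for a b c
    using jj unfolding jj_algebra_on_def by blast
  have vv: "m v v = 0"
  proof -
    obtain c where c: "m v v = s c v"
      using line by blast
    have "s (3 * (c * c)) v = s c (s c v) + s c (s c v) + s c (s c v)"
      by (simp add: scale_left_distrib[symmetric])
    also have "\<dots> = 0"
      using jac[of v v v] by (simp add: c scale_right)
    \<comment> \<open>Cancelling the nonzero scalar 3 leaves \<open>c = 0\<close> or
      \<open>v = 0\<close>, and \<open>s c v\<close> vanishes either way.\<close>
    finally show ?thesis
      using prime_neq_0_if_CHAR[of 3] assms(3) by (auto simp: c)
  qed
  have "m a v = 0" for a
  proof -
    obtain c where c: "m a v = s c v"
      using line by blast
    obtain d where d: "m a a = s d v"
      using line by blast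
    have "s (2 * (c * c)) v = s c (s c v) + s c (s c v)"
      by (simp add: scale_left_distrib[symmetric])
    \<comment> \<open>The third Jacobi term for \<open>(a, a, v)\<close> is
      \<open>m v (s d v)\<close>, zero by \<open>vv\<close>; the other two are
      \<open>s c (s c v)\<close> each.\<close>
    also have "\<dots> = 0"
      using jac[of a a v] by (simp add: c d vv comm[of v a] scale_right)
    finally show ?thesis
      using prime_neq_0_if_CHAR[of 2] assms(2) by (auto simp: c)
  qed
  then show "m a v = 0" "m v a = 0"
    by (simp_all add: comm[of v a])
qed

section \<open>Crossed systems of \<open>A_0\<close> by \<open>k\<close> and their classes\<close>

lemma form_mult_jj:
  assumes vs: "vector_space s" and "\<theta> \<in> sym_forms UNIV s"
  shows "jj_algebra_on UNIV (form_scale s) (form_mult \<theta>)"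
proof -
  interpret vector_space s by (rule vs)
  interpret P: vector_space "form_scale s"
    using vs by (rule form_scale_vector_space)
  \<comment> \<open>Products lie in \<open>0 \<times> k\<close> and \<open>\<theta>\<close> vanishes
    when an argument is 0, so each term of the Jacobi identity is zero by itself.\<close>
  show ?thesis
    using assms(2) bilinear_on_zero[of s s "(*)" \<theta>]
    by (auto simp: jj_algebra_on_def bilinear_on_def linear_on_def sym_forms_def form_mult_apply
        form_scale_apply[OF assms(1)] P.vector_space_axioms zero_prod_def)
qed

lemma crossed_systems_zero_mult:
  fixes s :: "'k::field \<Rightarrow> 'a::ab_group_add \<Rightarrow> 'a"
  assumes vs: "vector_space s" and char: "CHAR('k) \<noteq> 2" "CHAR('k) \<noteq> 3"
  shows "crossed_systems s zero_mult ((*) :: 'k \<Rightarrow> 'k \<Rightarrow> 'k) =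
    (\<lambda>\<theta>. (zero_mult, \<theta>, zero_mult)) ` sym_forms UNIV s"
proof (intro equalityI subsetI)
  fix p
  assume "p \<in> crossed_systems s zero_mult ((*) :: 'k \<Rightarrow> 'k \<Rightarrow> 'k)"
  then obtain t \<theta> mV where p: "p = (t, \<theta>, mV)"
    and t: "bilinear_on UNIV UNIV s (*) (*) t" and \<theta>: "bilinear_on UNIV UNIV s s (*) \<theta>"
    and mV: "bilinear_on UNIV UNIV (*) (*) (*) mV"
    and jj: "jj_algebra_on UNIV (form_scale s) (crossed_mult zero_mult (t, \<theta>, mV))"
    by (auto simp: crossed_systems_def)
  let ?m = "crossed_mult zero_mult (t, \<theta>, mV)"
  have zeros: "t 0 x = 0" "t a 0 = 0" "\<theta> 0 a = 0" "\<theta> a 0 = 0" "mV 0 x = 0" for a x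
    using t \<theta> mV by (simp_all add: bilinear_on_zero)
  \<comment> \<open>The zero multiplication on \<open>A\<close> confines all products to
    \<open>0 \<times> k\<close>, the line of \<open>(0, 1)\<close>.\<close>
  have line: "\<exists>c. ?m a b = form_scale s c (0, 1)" for a b
  proof -
    interpret vector_space s by (rule vs)
    show ?thesis
      by (cases a; cases b) (simp add: form_scale_apply[OF vs] zero_mult_def)
  qed
  have ann: "?m a (0, 1) = 0" for a
    by (rule jj_products_in_line_annihilate(1)[OF jj char line])
  \<comment> \<open>By \<open>zeros\<close>, the product of \<open>(a, 0)\<close> and
    \<open>(0, 1)\<close> is \<open>(0, t a 1)\<close>; below, \<open>(0, x)\<close> isolates
    \<open>mV x 1\<close> in the same way.\<close>
  have t1: "t a 1 = 0" for a
    using ann[of "(a, 0)"] by (simp add: zero_prod_def zeros)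
  \<comment> \<open>Since 1 spans \<open>k\<close>, a linear map out of \<open>k\<close> is
    determined by its value at 1.\<close>
  have "t a (x * 1) = x * t a 1" for a x
    using t unfolding bilinear_on_def linear_on_def by blast
  then have t0: "t = zero_mult"
    by (simp add: t1 zero_mult_def fun_eq_iff)
  have mV1: "mV x 1 = 0" for x
    using ann[of "(0, x)"] by (simp add: zero_prod_def zeros)
  have "mV x (y * 1) = y * mV x 1" for x y
    using mV unfolding bilinear_on_def linear_on_def by blast
  then have mV0: "mV = zero_mult"
    by (simp add: mV1 zero_mult_def fun_eq_iff)
  \<comment> \<open>With action and multiplication gone, commutativity of the crossed product is
    symmetry of the cocycle.\<close>
  have "?m (a, 0) (b, 0) = ?m (b, 0) (a, 0)" for a b
    using jj unfolding jj_algebra_on_def by blast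
  then have "\<theta> a b = \<theta> b a" for a b
    by (simp add: t0 mV0 zero_mult_def)
  then show "p \<in> (\<lambda>\<theta>. (zero_mult, \<theta>, zero_mult)) ` sym_forms UNIV s"
    using \<theta> by (simp add: p t0 mV0 sym_forms_def)
next
  fix p :: "('a, 'k) crossed_datum"
  assume "p \<in> (\<lambda>\<theta>. (zero_mult, \<theta>, zero_mult)) ` sym_forms UNIV s"
  then obtain \<theta> where "p = (zero_mult, \<theta>, zero_mult)" and "\<theta> \<in> sym_forms UNIV s"
    by blast
  then show "p \<in> crossed_systems s zero_mult (*)"
    using form_mult_jj[OF vs, of \<theta>]
    by (simp add: crossed_systems_def form_mult_def sym_forms_def)
      (simp add: bilinear_on_def linear_on_def zero_mult_def)
qed

text \<open>When the action and the multiplication on \<open>k\<close> are zero, the only correction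
  term left in the equivalence is \<open>r (mA a b) = r 0\<close>, zero by linearity. So no cocycle
  can change within its class.\<close>

lemma crossed_equiv_zero_mult:
  fixes s :: "'k::field \<Rightarrow> 'a::ab_group_add \<Rightarrow> 'a"
  assumes vs: "vector_space s" and char: "CHAR('k) \<noteq> 2" "CHAR('k) \<noteq> 3"
  shows "crossed_equiv s zero_mult ((*) :: 'k \<Rightarrow> 'k \<Rightarrow> 'k) =
    Id_on (crossed_systems s zero_mult (*))"
proof -
  interpret vector_space_pair s "(*) :: 'k \<Rightarrow> 'k \<Rightarrow> 'k"
    using vs by (rule vector_space_pair_field)
  let ?C = "crossed_systems s zero_mult ((*) :: 'k \<Rightarrow> 'k \<Rightarrow> 'k)"
  note C = crossed_systems_zero_mult[OF assms]
  show ?thesis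
  proof (intro equalityI subrelI)
    fix p q
    assume pq: "(p, q) \<in> crossed_equiv s zero_mult ((*) :: 'k \<Rightarrow> 'k \<Rightarrow> 'k)"
    then have "p \<in> ?C" "q \<in> ?C"
      by (auto simp: crossed_equiv_def)
    then obtain \<theta> \<theta>' where p: "p = (zero_mult, \<theta>, zero_mult)" and q: "q = (zero_mult, \<theta>', zero_mult)"
      unfolding C by blast
    obtain r where "Vector_Spaces.linear s ((*) :: 'k \<Rightarrow> 'k \<Rightarrow> 'k) r"
      and "\<theta> a b = \<theta>' a b - r 0" for a b
      using pq by (auto simp: crossed_equiv_def p q zero_mult_def)
    then have "\<theta> = \<theta>'"
      by (simp add: linear_0 fun_eq_iff)
    with \<open>p \<in> ?C\<close> show "(p, q) \<in> Id_on ?C"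
      by (simp add: p q Id_on_iff)
  next
    fix p q
    assume "(p, q) \<in> Id_on ?C"
    then have "q = p" and "p \<in> ?C"
      by auto
    then obtain \<theta> where p: "p = (zero_mult, \<theta>, zero_mult)"
      unfolding C by blast
    show "(p, q) \<in> crossed_equiv s zero_mult (*)"
      using \<open>p \<in> ?C\<close> linear_zero
      by (auto simp: \<open>q = p\<close> p crossed_equiv_def zero_mult_def intro!: exI[of _ "\<lambda>_. 0"])
  qed
qed

text \<open>Every crossed system here already has zero multiplication on \<open>k\<close>, so fixing
  the third component removes nothing; every class is a singleton, so a form is recovered from its
  class.\<close>

lemma GH2_eq_H2_sym_forms:
  fixes s :: "'k::field \<Rightarrow> 'a::ab_group_add \<Rightarrow> 'a"
  assumes vs: "vector_space s" and char: "CHAR('k) \<noteq> 2" "CHAR('k) \<noteq> 3"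
  shows "GH2 s zero_mult ((*) :: 'k \<Rightarrow> 'k \<Rightarrow> 'k) = H2 s zero_mult (*) zero_mult"
    and "bij_betw
      (\<lambda>\<theta>. crossed_equiv s zero_mult ((*) :: 'k \<Rightarrow> 'k \<Rightarrow> 'k) `` {(zero_mult, \<theta>, zero_mult)})
      (sym_forms UNIV s) (H2 s zero_mult (*) zero_mult)"
proof -
  let ?C = "crossed_systems s zero_mult ((*) :: 'k \<Rightarrow> 'k \<Rightarrow> 'k)"
  have C: "{p \<in> ?C. snd (snd p) = zero_mult} = ?C"
    by (auto simp: crossed_systems_zero_mult[OF assms])
  show "GH2 s zero_mult ((*) :: 'k \<Rightarrow> 'k \<Rightarrow> 'k) = H2 s zero_mult (*) zero_mult"
    by (simp add: GH2_def H2_def C)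
  have cls: "crossed_equiv s zero_mult (*) `` {(zero_mult, \<theta>, zero_mult)} =
      {(zero_mult, \<theta>, zero_mult :: 'k \<Rightarrow> 'k \<Rightarrow> 'k)}" if "\<theta> \<in> sym_forms UNIV s" for \<theta>
  proof -
    have "(zero_mult, \<theta>, zero_mult) \<in> ?C"
      unfolding crossed_systems_zero_mult[OF assms] using that by (rule imageI)
    moreover have "Id_on X `` {p} = {p}" if "p \<in> X" for X and p :: "('a, 'k) crossed_datum"
      using that by blast
    ultimately show ?thesis
      unfolding crossed_equiv_zero_mult[OF assms] by simp
  qed
  have "H2 s zero_mult ((*) :: 'k \<Rightarrow> 'k \<Rightarrow> 'k) zero_mult =
      (\<lambda>\<theta>. crossed_equiv s zero_mult (*) `` {(zero_mult, \<theta>, zero_mult)}) ` sym_forms UNIV s"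
    by (simp only: H2_def C quotient_def UNION_singleton_eq_range)
      (simp only: crossed_systems_zero_mult[OF assms] image_image)
  then show "bij_betw
      (\<lambda>\<theta>. crossed_equiv s zero_mult ((*) :: 'k \<Rightarrow> 'k \<Rightarrow> 'k) `` {(zero_mult, \<theta>, zero_mult)})
      (sym_forms UNIV s) (H2 s zero_mult (*) zero_mult)"
    by (auto simp: bij_betw_def inj_on_def cls)
qed

section \<open>Derived algebras of dimension 1\<close>

lemma (in vector_space) dim_eq_1_span:
  assumes "subspace U" and "dim U = 1"
  obtains v where "v \<noteq> 0" and "U = range (\<lambda>c. scale c v)"
proof -
  obtain B where B: "B \<subseteq> U" "independent B" "U \<subseteq> span B" "card B = dim U"
    by (rule basis_exists)
  then obtain v where v: "B = {v}"
    using assms(2) by (metis card_1_singletonE)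
  then have "U = span {v}"
    using B assms(1) by (metis span_minimal subset_antisym)
  moreover have "v \<noteq> 0"
    using B(2) v dependent_zero by blast
  ultimately show thesis
    using that by (simp add: span_singleton)
qed

text \<open>The complement of \<open>kv\<close> is the kernel of a functional \<open>l\<close> with
  \<open>l v = 1\<close>, and \<open>\<theta>\<close> is the \<open>v\<close>-coordinate of the
  product. Choosing the complement inside the algebra keeps the existential claim within the type
  \<open>'j\<close>.\<close>

lemma jj_derived_dim_1_imp_form:
  fixes s :: "'k::field \<Rightarrow> 'j::ab_group_add \<Rightarrow> 'j"
  assumes jj: "jj_algebra_on UNIV s m" and char: "CHAR('k) \<noteq> 2" "CHAR('k) \<noteq> 3"
    and dim: "vector_space.dim s (derived_algebra UNIV s m) = 1"
  obtains A \<theta> where "module.subspace s A" and "\<theta> \<in> sym_forms A s"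
    and "\<exists>a\<in>A. \<exists>b\<in>A. \<theta> a b \<noteq> 0"
    and "algebras_isomorphic UNIV s m (A \<times> UNIV) (form_scale s) (form_mult \<theta>)"
proof -
  have vs: "vector_space s"
    using jj by (simp add: jj_algebra_on_def)
  interpret vector_space s by (rule vs)
  interpret P: vector_space_pair s "(*) :: 'k \<Rightarrow> 'k \<Rightarrow> 'k"
    using vs by (rule vector_space_pair_field)
  have m_add: "m (a + b) c = m a c + m b c" "m c (a + b) = m c a + m c b"
    and m_scale: "m (s k a) c = s k (m a c)" "m c (s k a) = s k (m c a)"
    and m_comm: "m a b = m b a" for a b c k
    using jj by (simp_all add: jj_algebra_on_def bilinear_on_def linear_on_def)
  have "subspace (derived_algebra UNIV s m)"
    by (simp add: derived_algebra_def)
  then obtain v where "v \<noteq> 0" and D: "derived_algebra UNIV s m = range (\<lambda>c. s c v)"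
    using dim by (rule dim_eq_1_span)
  have "m a b \<in> derived_algebra UNIV s m" for a b
    unfolding derived_algebra_def by (rule span_base) blast
  then have line: "\<exists>c. m a b = s c v" for a b
    unfolding D by blast
  note ann = jj_products_in_line_annihilate[OF jj char line]
  have ind: "independent {v}"
    using \<open>v \<noteq> 0\<close> by simp
  \<comment> \<open>Extends the coordinate functional of the line \<open>kv\<close> to the whole
    space.\<close>
  define l where "l = P.construct {v} (\<lambda>_. 1 :: 'k)"
  have l: "Vector_Spaces.linear s (*) l"
    unfolding l_def using ind by (rule P.linear_construct)
  have lv: "l v = 1"
    unfolding l_def using ind by (simp add: P.construct_basis)
  have l_add: "l (a + b) = l a + l b" and l_scale: "l (s c a) = c * l a" for a b c
    using P.linear_add[OF l] P.linear_scale[OF l] by auto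
  have l_diff: "l (a - b) = l a - l b" for a b
    using P.linear_diff[OF l] .
  have m_l: "m a b = s (l (m a b)) v" for a b
    using line[of a b] by (auto simp: l_scale lv)
  define A where "A = {a. l a = 0}"
  \<comment> \<open>The projection onto the kernel \<open>A\<close> along \<open>v\<close>; it
    preserves products because \<open>v\<close> annihilates everything.\<close>
  define pr where "pr a = a - s (l a) v" for a
  have pr_A: "pr a \<in> A" for a
    by (simp add: A_def pr_def l_diff l_scale lv)
  have m_pr: "m (pr a) (pr b) = m a b" for a b
  proof -
    have "m a b = m (pr a + s (l a) v) (pr b + s (l b) v)"
      by (simp add: pr_def)
    also have "\<dots> = m (pr a) (pr b)"
      by (simp add: m_add m_scale ann)
    finally show ?thesis ..
  qed
  define \<theta> where "\<theta> a b = l (m a b)" for a b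
  show thesis
  proof
    show "subspace A"
      by (auto simp: A_def subspace_def l_add l_scale P.linear_0[OF l])
    show "\<theta> \<in> sym_forms A s"
      using m_comm
      by (simp add: sym_forms_def bilinear_on_def linear_on_def \<theta>_def m_add m_scale l_add l_scale)
    \<comment> \<open>Were all products zero, so would be their span, yet it contains
      \<open>v\<close>. Projecting with \<open>pr\<close> then yields a nonzero value of
      \<open>\<theta>\<close> on \<open>A\<close> itself.\<close>
    have "\<exists>a b. m a b \<noteq> 0"
    proof (rule ccontr)
      assume "\<not> ?thesis"
      then have "derived_algebra UNIV s m \<subseteq> {0}"
        unfolding derived_algebra_def by (intro span_minimal) auto
      moreover have "s 1 v \<in> derived_algebra UNIV s m"
        unfolding D by blast
      ultimately show False
        using \<open>v \<noteq> 0\<close> by auto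
    qed
    then obtain a b where "m a b \<noteq> 0"
      by blast
    then have "\<theta> (pr a) (pr b) \<noteq> 0"
      using m_l[of a b] by (auto simp: \<theta>_def m_pr)
    then show "\<exists>a\<in>A. \<exists>b\<in>A. \<theta> a b \<noteq> 0"
      using pr_A by blast
    define f where "f a = (pr a, l a)" for a
    have "bij_betw f UNIV (A \<times> UNIV)"
    proof (rule bij_betw_byWitness[where f' = "\<lambda>(a, x). a + s x v"])
      show "\<forall>a\<in>UNIV. (\<lambda>(a, x). a + s x v) (f a) = a"
        by (simp add: f_def pr_def)
      show "\<forall>p\<in>A \<times> UNIV. f ((\<lambda>(a, x). a + s x v) p) = p"
        by (auto simp: f_def pr_def A_def l_add l_scale lv)
    qed (auto simp: f_def pr_A)
    moreover have "linear_on UNIV s (form_scale s) f"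
      by (simp add: linear_on_def f_def pr_def form_scale_apply[OF vs] l_add l_scale algebra_simps)
    moreover have "f (m a b) = form_mult \<theta> (f a) (f b)" for a b
    proof -
      \<comment> \<open>Products are multiples of \<open>v\<close>, which \<open>pr\<close> kills;
        this matches the zero first coordinate of \<open>form_mult\<close>.\<close>
      have "pr (m a b) = 0"
        using m_l[of a b] by (simp add: pr_def)
      then show ?thesis
        by (simp add: f_def form_mult_apply \<theta>_def m_pr)
    qed
    ultimately show "algebras_isomorphic UNIV s m (A \<times> UNIV) (form_scale s) (form_mult \<theta>)"
      unfolding algebras_isomorphic_def by blast
  qed
qed

text \<open>The isomorphism pulls the derived algebra \<open>0 \<times> k\<close> of
  \<open>A_\<theta>\<close> back to the line of \<open>v\<close>, the preimage of
  \<open>(0, 1)\<close>. The space around \<open>A\<close> has its own type, so that the lemma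
  serves both a subspace of the algebra and an unrelated space.\<close>

lemma isomorphic_form_imp_derived_dim_1:
  fixes s :: "'k::field \<Rightarrow> 'j::ab_group_add \<Rightarrow> 'j" and s' :: "'k \<Rightarrow> 'a::ab_group_add \<Rightarrow> 'a"
  assumes vs: "vector_space s" and vs': "vector_space s'"
    and A: "module.subspace s' A" and nz: "\<exists>a\<in>A. \<exists>b\<in>A. \<theta> a b \<noteq> 0"
    and iso: "algebras_isomorphic UNIV s m (A \<times> UNIV) (form_scale s') (form_mult \<theta>)"
  shows "vector_space.dim s (derived_algebra UNIV s m) = 1"
proof -
  interpret vector_space s by (rule vs)
  interpret V': vector_space s' by (rule vs')
  obtain f where f: "bij_betw f UNIV (A \<times> UNIV)"
    and f_scale: "\<And>c x. f (s c x) = form_scale s' c (f x)"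
    and f_mult: "\<And>a b. f (m a b) = form_mult \<theta> (f a) (f b)"
    using iso by (auto simp: algebras_isomorphic_def linear_on_def)
  have inj: "f x = f y \<Longrightarrow> x = y" for x y
    using f by (simp add: bij_betw_def inj_eq)
  have surj: "\<exists>x. f x = (a, c)" if "a \<in> A" for a c
    using f that by (metis (no_types, lifting) SigmaI UNIV_I bij_betw_imp_surj_on image_iff)
  obtain v where v: "f v = (0, 1)"
    using surj V'.subspace_0[OF A] by blast
  have line: "m a b = s (\<theta> (fst (f a)) (fst (f b))) v" for a b
    by (rule inj, cases "f a", cases "f b")
      (simp add: f_mult f_scale v form_scale_apply[OF vs'] form_mult_apply)
  obtain a b where "\<theta> a b \<noteq> 0" "a \<in> A" "b \<in> A"
    using nz by blast
  then obtain x y where xy: "f x = (a, 0)" "f y = (b, 0)"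
    using surj by blast
  \<comment> \<open>The nonzero value \<open>\<theta> a b\<close> is invertible, so \<open>v\<close>
    is a multiple of a product.\<close>
  have "v = s (inverse (\<theta> a b)) (m x y)"
    using \<open>\<theta> a b \<noteq> 0\<close> by (simp add: line xy)
  moreover have "m x y \<in> derived_algebra UNIV s m"
    unfolding derived_algebra_def by (rule span_base) blast
  ultimately have "v \<in> derived_algebra UNIV s m"
    unfolding derived_algebra_def using span_scale by blast
  moreover have "derived_algebra UNIV s m \<subseteq> span {v}"
    unfolding derived_algebra_def by (rule span_minimal) (auto simp: line span_base span_scale)
  \<comment> \<open>\<open>f\<close> sends 0 to 0, whereas \<open>f v = (0, 1)\<close>.\<close>
  moreover have "v \<noteq> 0"
    using f_scale[of 0 v] v by (auto simp: form_scale_apply[OF vs'])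
  ultimately show ?thesis
    by (intro dim_unique[of "{v}"]) auto
qed

section \<open>Isomorphisms of the algebras \<open>A_\<theta>\<close> and homothety of forms\<close>

lemma isomorphic_forms_imp_homothetic:
  fixes s :: "'k::field \<Rightarrow> 'a::ab_group_add \<Rightarrow> 'a"
  assumes vs: "vector_space s"
    and iso: "algebras_isomorphic UNIV (form_scale s) (form_mult \<theta>)
      UNIV (form_scale s) (form_mult \<theta>')"
  obtains s0 \<psi> where "s0 \<noteq> 0" and "Vector_Spaces.linear s s \<psi>" and "bij \<psi>"
    and "\<And>a b. s0 * \<theta> a b = \<theta>' (\<psi> a) (\<psi> b)"
proof -
  interpret vector_space s by (rule vs)
  obtain f where bij: "bij f"
    and f_add: "\<And>p q. f (p + q) = f p + f q"
    and f_scale: "\<And>c p. f (form_scale s c p) = form_scale s c (f p)"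
    and f_mult: "\<And>p q. f (form_mult \<theta> p q) = form_mult \<theta>' (f p) (f q)"
    using iso by (auto simp: algebras_isomorphic_def linear_on_def)
  \<comment> \<open>The second coordinates \<open>x\<close> and \<open>y\<close> do not affect
    products and stay free, since preimages under \<open>f\<close> may have arbitrary ones.\<close>
  have f_form: "f (0, \<theta> a b) = (0, \<theta>' (fst (f (a, x))) (fst (f (b, y))))" for a b x y
    using f_mult[of "(a, x)" "(b, y)"]
    by (metis form_mult_apply prod.collapse)
  have f_axis: "f (0, x) = form_scale s x (f (0, 1))" for x
    using f_scale[of x "(0, 1)"] by (simp add: form_scale_apply[OF vs])
  have f00: "f (0, 0) = (0, 0)"
    using f_axis[of 0] by (cases "f (0, 1)") (simp add: form_scale_apply[OF vs])
  have inj: "f p = f q \<Longrightarrow> p = q" for p q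
    using bij by (simp add: bij_is_inj inj_eq)
  show thesis
  proof (cases "\<exists>a b. \<theta> a b \<noteq> 0")
    case False
    \<comment> \<open>For \<open>\<theta> = 0\<close> the map \<open>f\<close> need not preserve
      \<open>0 \<times> k\<close>, so \<open>\<psi>\<close> is not read off from it. Surjectivity
      forces \<open>\<theta>' = 0\<close>, and then 1 and \<open>id\<close> will do.\<close>
    have "\<theta>' c d = 0" for c d
    proof -
      obtain p q where "f p = (c, 0)" "f q = (d, 0)"
        using bij by (metis bij_pointE)
      then show ?thesis
        using f_form[of "fst p" "fst q" "snd p" "snd q"] False f00 by simp
    qed
    then show thesis
      using False that[of 1 id] by (simp add: linear_id)
  next
    case True
    then obtain a b where ab: "\<theta> a b \<noteq> 0"
      by blast
    \<comment> \<open>A nonzero multiple of \<open>f (0, 1)\<close> is the image of a product, hence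
      a product, hence in \<open>0 \<times> k\<close>; so \<open>f (0, 1)\<close> lies there
      too.\<close>
    have "form_scale s (\<theta> a b) (f (0, 1)) = (0, \<theta>' (fst (f (a, 0))) (fst (f (b, 0))))"
      using f_form[of a b 0 0] by (simp only: f_axis[of "\<theta> a b"])
    then have "fst (f (0, 1)) = 0"
      using ab by (cases "f (0, 1)") (simp add: form_scale_apply[OF vs])
    then obtain s0 where s0: "f (0, 1) = (0, s0)"
      by (metis prod.collapse)
    have f_axis': "f (0, x) = (0, x * s0)" for x
      using f_axis[of x] by (simp add: s0 form_scale_apply[OF vs])
    have "s0 \<noteq> 0"
      using inj[of "(0, 1)" "(0, 0)"] by (auto simp: s0 f00)
    \<comment> \<open>The map induced by \<open>f\<close> on the quotient by
      \<open>0 \<times> k\<close>; \<open>fst_f\<close> is its independence of the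
      representative.\<close>
    define \<psi> where "\<psi> a = fst (f (a, 0))" for a
    have fst_f: "fst (f (a, x)) = \<psi> a" for a x
      using f_add[of "(a, 0)" "(0, x)"] by (simp add: \<psi>_def f_axis')
    show thesis
    proof
      show "s0 \<noteq> 0" by fact
      have "\<psi> (a + b) = \<psi> a + \<psi> b" for a b
        using f_add[of "(a, 0)" "(b, 0)"] by (simp add: \<psi>_def)
      moreover have "\<psi> (s c a) = s c (\<psi> a)" for c a
        using f_scale[of c "(a, 0)"] unfolding \<psi>_def
        by (cases "f (a, 0)") (simp add: form_scale_apply[OF vs])
      ultimately show lin: "Vector_Spaces.linear s s \<psi>"
        using vs by (simp add: Vector_Spaces.linear_iff)
      interpret vector_space_pair s s
        using vs by (simp add: vector_space_pair_def)
      \<comment> \<open>If \<open>\<psi> a = 0\<close>, then \<open>f (a, 0)\<close> lies in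
        \<open>0 \<times> k\<close>, where it is already the image of a point of
        \<open>0 \<times> k\<close>; injectivity of \<open>f\<close> gives
        \<open>a = 0\<close>.\<close>
      have "a = 0" if "\<psi> a = 0" for a
      proof -
        have "f (a, 0) = f (0, snd (f (a, 0)) / s0)"
          using that \<open>s0 \<noteq> 0\<close> by (simp add: f_axis' \<psi>_def prod_eq_iff)
        then show ?thesis
          using inj by blast
      qed
      then have "inj \<psi>"
        using linear_inj_iff_eq_0[OF lin] by blast
      moreover have "surj \<psi>"
      proof (rule surjI)
        show "\<psi> (fst (inv f (b, 0))) = b" for b
          using fst_f[of "fst (inv f (b, 0))" "snd (inv f (b, 0))"] bij
          by (simp add: bij_is_surj surj_f_inv_f)
      qed
      ultimately show "bij \<psi>"
        by (simp add: bij_def)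
      show "s0 * \<theta> a b = \<theta>' (\<psi> a) (\<psi> b)" for a b
        using f_form[of a b 0 0] by (simp add: f_axis' fst_f mult.commute)
    qed
  qed
qed

text \<open>The isomorphism is \<open>(a, x) \<mapsto> (\<psi> a, s0 x)\<close>; its
  multiplicativity in the second coordinate is exactly the homothety relation.\<close>

lemma homothetic_imp_isomorphic_forms:
  fixes s :: "'k::field \<Rightarrow> 'a::ab_group_add \<Rightarrow> 'a"
  assumes vs: "vector_space s" and "s0 \<noteq> 0" and lin: "Vector_Spaces.linear s s \<psi>" and "bij \<psi>"
    and hom: "\<And>a b. s0 * \<theta> a b = \<theta>' (\<psi> a) (\<psi> b)"
  shows "algebras_isomorphic UNIV (form_scale s) (form_mult \<theta>)
    UNIV (form_scale s) (form_mult \<theta>')"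
proof -
  define f where "f = map_prod \<psi> ((*) s0)"
  have "bij ((*) s0)"
    using \<open>s0 \<noteq> 0\<close> by (intro bij_betw_byWitness[where f' = "\<lambda>x. x / s0"]) auto
  then have "bij f"
    unfolding f_def using bij_betw_map_prod[OF \<open>bij \<psi>\<close>, of "(*) s0" UNIV UNIV] by simp
  \<comment> \<open>Products have first coordinate 0, which must go to 0.\<close>
  moreover have "\<psi> 0 = 0"
    using lin by (metis Vector_Spaces.linear_iff add_cancel_right_right)
  ultimately show ?thesis
    unfolding algebras_isomorphic_def
    using lin
    by (intro exI[of _ f])
      (auto simp: f_def linear_on_def form_scale_apply[OF vs] form_mult_apply hom[symmetric]
        Vector_Spaces.linear_iff algebra_simps)
qed

text \<open>An existential quantifier cannot range over types, so clause (2) is split: the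
  equivalence takes \<open>A\<close> among the subspaces of the algebra, and the implication after
  it covers \<open>A\<close> in the arbitrary type \<open>'a\<close>, which gives the converse in
  full. Clause (1) pins the bijection down as the class map.\<close>

theorem proposition3p13:
  fixes scale :: "'k::field \<Rightarrow> 'a::ab_group_add \<Rightarrow> 'a"
    and scaleJ :: "'k \<Rightarrow> 'j::ab_group_add \<Rightarrow> 'j"
  assumes "CHAR('k) \<noteq> 2" and "CHAR('k) \<noteq> 3"
    and "vector_space scale" and "vector_space scaleJ"
  shows
    "(GH2 scale zero_mult ((*) :: 'k \<Rightarrow> 'k \<Rightarrow> 'k) = H2 scale zero_mult (*) zero_mult \<and>
      (\<exists>\<Phi>. bij_betw \<Phi> (sym_forms UNIV scale) (H2 scale zero_mult (*) zero_mult) \<and>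
        (\<forall>\<theta>\<in>sym_forms UNIV scale.
          (zero_mult, \<theta>, zero_mult) \<in> crossed_systems scale zero_mult (*) \<and>
          \<Phi> \<theta> = crossed_equiv scale zero_mult (*) `` {(zero_mult, \<theta>, zero_mult)} \<and>
          jj_algebra_on UNIV (form_scale scale) (form_mult \<theta>) \<and>
          (\<forall>a b x y. form_mult \<theta> (a, x) (b, y) = (0, \<theta> a b)))))
    \<and>
    (\<forall>m. jj_algebra_on UNIV scaleJ m \<and> metabelian_on UNIV m \<longrightarrow>
      (vector_space.dim scaleJ (derived_algebra UNIV scaleJ m) = 1 \<longleftrightarrow>
        (\<exists>A \<theta>. module.subspace scaleJ A \<and> \<theta> \<in> sym_forms A scaleJ \<and>
          (\<exists>a\<in>A. \<exists>b\<in>A. \<theta> a b \<noteq> 0) \<and>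
          algebras_isomorphic UNIV scaleJ m (A \<times> UNIV) (form_scale scaleJ) (form_mult \<theta>))) \<and>
      (\<forall>A \<theta>. module.subspace scale A \<and> \<theta> \<in> sym_forms A scale \<and>
          (\<exists>a\<in>A. \<exists>b\<in>A. \<theta> a b \<noteq> 0) \<and>
          algebras_isomorphic UNIV scaleJ m (A \<times> UNIV) (form_scale scale) (form_mult \<theta>) \<longrightarrow>
        vector_space.dim scaleJ (derived_algebra UNIV scaleJ m) = 1))
    \<and>
    (\<forall>\<theta>\<in>sym_forms UNIV scale. \<forall>\<theta>'\<in>sym_forms UNIV scale.
      algebras_isomorphic UNIV (form_scale scale) (form_mult \<theta>)
          UNIV (form_scale scale) (form_mult \<theta>') \<longleftrightarrow>
        (\<exists>s0 \<psi>. s0 \<noteq> 0 \<and> Vector_Spaces.linear scale scale \<psi> \<and> bij \<psi> \<and>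
          (\<forall>a b. s0 * \<theta> a b = \<theta>' (\<psi> a) (\<psi> b))))"
proof (intro conjI allI impI ballI)
  show "GH2 scale zero_mult ((*) :: 'k \<Rightarrow> 'k \<Rightarrow> 'k) = H2 scale zero_mult (*) zero_mult"
    using assms by (intro GH2_eq_H2_sym_forms)
next
  show "\<exists>\<Phi>. bij_betw \<Phi> (sym_forms UNIV scale) (H2 scale zero_mult (*) zero_mult) \<and>
      (\<forall>\<theta>\<in>sym_forms UNIV scale.
        (zero_mult, \<theta>, zero_mult) \<in> crossed_systems scale zero_mult (*) \<and>
        \<Phi> \<theta> = crossed_equiv scale zero_mult (*) `` {(zero_mult, \<theta>, zero_mult)} \<and>
        jj_algebra_on UNIV (form_scale scale) (form_mult \<theta>) \<and>
        (\<forall>a b x y. form_mult \<theta> (a, x) (b, y) = (0, \<theta> a b)))"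
    using assms GH2_eq_H2_sym_forms(2)[of scale]
    by (intro exI[of _ "\<lambda>\<theta>. crossed_equiv scale zero_mult (*) `` {(zero_mult, \<theta>, zero_mult)}"])
      (auto simp: crossed_systems_zero_mult form_mult_jj form_mult_apply)
next
  fix m
  assume "jj_algebra_on UNIV scaleJ m \<and> metabelian_on UNIV m"
  then have jj: "jj_algebra_on UNIV scaleJ m" ..
  show "vector_space.dim scaleJ (derived_algebra UNIV scaleJ m) = 1 \<longleftrightarrow>
      (\<exists>A \<theta>. module.subspace scaleJ A \<and> \<theta> \<in> sym_forms A scaleJ \<and>
        (\<exists>a\<in>A. \<exists>b\<in>A. \<theta> a b \<noteq> 0) \<and>
        algebras_isomorphic UNIV scaleJ m (A \<times> UNIV) (form_scale scaleJ) (form_mult \<theta>))"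
    (is "?dim \<longleftrightarrow> ?form")
  proof
    show ?form if ?dim
      by (rule jj_derived_dim_1_imp_form[OF jj assms(1,2) that]) blast
    show ?dim if ?form
      using that isomorphic_form_imp_derived_dim_1[OF assms(4,4)] by blast
  qed
next
  fix m A \<theta>
  assume "module.subspace scale A \<and> \<theta> \<in> sym_forms A scale \<and> (\<exists>a\<in>A. \<exists>b\<in>A. \<theta> a b \<noteq> 0) \<and>
    algebras_isomorphic UNIV scaleJ m (A \<times> UNIV) (form_scale scale) (form_mult \<theta>)"
  then show "vector_space.dim scaleJ (derived_algebra UNIV scaleJ m) = 1"
    using isomorphic_form_imp_derived_dim_1[OF assms(4,3)] by blast
next
  fix \<theta> \<theta>'
  show "algebras_isomorphic UNIV (form_scale scale) (form_mult \<theta>)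
        UNIV (form_scale scale) (form_mult \<theta>') \<longleftrightarrow>
      (\<exists>s0 \<psi>. s0 \<noteq> 0 \<and> Vector_Spaces.linear scale scale \<psi> \<and> bij \<psi> \<and>
        (\<forall>a b. s0 * \<theta> a b = \<theta>' (\<psi> a) (\<psi> b)))"
    (is "?iso \<longleftrightarrow> ?homothetic")
  proof
    show ?homothetic if ?iso
      by (rule isomorphic_forms_imp_homothetic[OF assms(3) that]) blast
    show ?iso if ?homothetic
      using that homothetic_imp_isomorphic_forms[OF assms(3)] by blast
  qed
qed

end
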